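(* Let $C \subset \mathbb{R}^d$ be a compact set and let $f \colon C \to \mathbb{R}$ be a continuous convex function. Then $f$ extends to a continuous convex function on the convex hull $K = \operatorname{co}(C)$ if and only if $f$ extends to a continuous convex function on $\operatorname{bd}(K)$.
   Context: For a convex set $K \subset \mathbb{R}^d$, $\operatorname{ri}(K)$ denotes its relative interior (the topological interior of $K$ inside its affine hull) and $\operatorname{bd}(K) = \overline{K} \setminus \operatorname{ri}(K)$ its relative boundary; $\operatorname{co}$ denotes convex hull. A function $f \colon S \to \mathbb{R}$ on a (not necessarily convex) set $S \subset \mathbb{R}^d$ is called convex if $f(x) \le \sum_{j=1}^k t_j f(x_j)$ for any finite collection $x, x_1,\dots,x_k \in S$ and $t_1,\dots,t_k \in [0,1]$ with $\sum_j t_j = 1$ and $\sum_j t_j x_j = x$. *)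

theory Defs
  imports "HOL-Analysis.Analysis"
begin

text \<open>
  Convexity of a real function on an arbitrary, not necessarily convex, set. The library's
  \<^const>\<open>convex_on\<close> requires the domain to be convex; on convex domains the two notions agree
  (lemma \<open>convex_fun_on_iff_convex_on\<close> below).
\<close>

definition convex_fun_on :: "'a::real_vector set \<Rightarrow> ('a \<Rightarrow> real) \<Rightarrow> bool" where
  "convex_fun_on S f \<longleftrightarrow>
     (\<forall>(k::nat) x (y :: nat \<Rightarrow> 'a) (t :: nat \<Rightarrow> real).
        x \<in> S \<longrightarrow> (\<forall>j\<in>{1..k}. y j \<in> S) \<longrightarrow> (\<forall>j\<in>{1..k}. t j \<in> {0..1}) \<longrightarrow>
        (\<Sum>j=1..k. t j) = 1 \<longrightarrow> (\<Sum>j=1..k. t j *\<^sub>R y j) = x \<longrightarrow>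
        f x \<le> (\<Sum>j=1..k. t j * f (y j)))"

text \<open>
  A function on \<open>C\<close> is represented by a total function of which only the values on \<open>C\<close> matter.
  An extension is defined on a superset of \<open>C\<close>, hence the requirement \<open>C \<subseteq> D\<close>.
  In particular, extending a function on \<open>C\<close> to a further set \<open>B\<close> not containing \<open>C\<close> means
  extending it to the domain \<open>C \<union> B\<close>: the extension is convex and continuous jointly on
  \<open>C\<close> and \<open>B\<close>, not only on \<open>B\<close>.
\<close>

definition extends_cont_convex ::
    "'a::real_normed_vector set \<Rightarrow> ('a \<Rightarrow> real) \<Rightarrow> 'a set \<Rightarrow> bool" where
  "extends_cont_convex C f D \<longleftrightarrow>
     C \<subseteq> D \<and> (\<exists>g. continuous_on D g \<and> convex_fun_on D g \<and> (\<forall>x\<in>C. g x = f x))"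

lemma convex_fun_on_iff_convex_on:
  assumes "convex S"
  shows "convex_fun_on S f \<longleftrightarrow> convex_on S f"
proof
  assume L: "convex_fun_on S f"
  show "convex_on S f"
  proof (rule convex_onI[OF _ assms])
    fix t :: real and x y
    assume t: "0 < t" "t < 1" and xy: "x \<in> S" "y \<in> S"
    let ?y = "\<lambda>j::nat. if j = 1 then x else y"
    let ?t = "\<lambda>j::nat. if j = 1 then 1 - t else t"
    have eq: "{Suc 0..2} = {Suc 0, 2}" by auto
    have "(1 - t) *\<^sub>R x + t *\<^sub>R y \<in> S"
      using assms t xy by (auto simp: convex_alt)
    then show "f ((1 - t) *\<^sub>R x + t *\<^sub>R y) \<le> (1 - t) * f x + t * f y"
      using L[unfolded convex_fun_on_def, rule_format,
          of "(1 - t) *\<^sub>R x + t *\<^sub>R y" 2 ?y ?t] t xy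
      by (auto simp: eq)
  qed
next
  assume R: "convex_on S f"
  show "convex_fun_on S f"
    unfolding convex_fun_on_def
  proof (intro allI impI)
    fix k :: nat and x and y :: "nat \<Rightarrow> 'a" and t :: "nat \<Rightarrow> real"
    assume H: "\<forall>j\<in>{1..k}. y j \<in> S" "\<forall>j\<in>{1..k}. t j \<in> {0..1}" "(\<Sum>j=1..k. t j) = 1"
      "(\<Sum>j=1..k. t j *\<^sub>R y j) = x"
    have "{1..k} \<noteq> {}" using H(3) by (metis sum.empty zero_neq_one)
    then have "f (\<Sum>j=1..k. t j *\<^sub>R y j) \<le> (\<Sum>j=1..k. t j * f (y j))"
      using H(1-3) by (intro convex_on_sum[OF _ _ R]) auto
    then show "f x \<le> (\<Sum>j=1..k. t j * f (y j))" by (simp only: H(4))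
  qed
qed

end

theory Submission
  imports Defs
begin

text \<open>
  The interesting direction extends a continuous convex \<open>g\<close> from a compact set \<open>D\<close> that contains
  the relative boundary of \<open>K = co(D)\<close> to all of \<open>K\<close>; it is then applied to
  \<open>D = C \<union> bd(co(C))\<close>, whose convex hull is again \<open>co(C)\<close>.

  The extension is the lower boundary \<open>F\<close> of the convex hull \<open>G\<close> of the graph of \<open>g\<close>, that is,
  the largest convex function on \<open>K\<close> below \<open>g\<close> on \<open>D\<close>. It agrees with \<open>g\<close> on \<open>D\<close> precisely because
  \<open>g\<close> is convex in the sense of finite convex combinations. Continuity is a matter of compactness.
  A function is upper semicontinuous at \<open>x0\<close> as soon as it is dominated by a compact subset
  of the product with \<open>\<real>\<close> whose fibre over \<open>x0\<close> does not exceed the value at \<open>x0\<close>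
  (\<open>eventually_less_of_compact_majorant\<close>). For \<open>-F\<close> the reflection of \<open>G\<close> is such a set, which
  gives lower semicontinuity. For \<open>F\<close> it is the cone over the graph of \<open>g\<close> on \<open>bd(K)\<close> with apex
  \<open>(p, F p)\<close>, where \<open>p\<close> is a relative interior point: each point of \<open>K\<close> other than \<open>p\<close> lies on a
  segment from \<open>p\<close> to some boundary point, and \<open>F\<close> lies below the chord by convexity. Over a boundary point
  the cone contains only the value of \<open>g\<close>, and over \<open>p\<close> only \<open>F p\<close>. The choice \<open>p = x0\<close> therefore
  serves for \<open>x0\<close> in the relative interior, and any \<open>p\<close> serves for \<open>x0\<close> on the boundary.
\<close>

text \<open>
  The points of \<open>H\<close> at height at least \<open>b\<close> project to a compact set that misses \<open>x0\<close>, so the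
  complement of this projection is a neighbourhood of \<open>x0\<close> on which \<open>F\<close> stays below \<open>b\<close>.
\<close>

lemma eventually_less_of_compact_majorant:
  fixes H :: "('a::t2_space \<times> real) set"
  assumes "compact H"
    and major: "\<And>x. x \<in> K \<Longrightarrow> \<exists>v\<ge>F x. (x, v) \<in> H"
    and fibre: "\<And>v. (x0, v) \<in> H \<Longrightarrow> v \<le> F x0"
    and "F x0 < b"
  shows "\<forall>\<^sub>F x in at x0 within K. F x < b"
proof -
  let ?A = "fst ` (H \<inter> UNIV \<times> {b..})"
  have "compact (H \<inter> UNIV \<times> {b..})"
    by (intro compact_Int_closed \<open>compact H\<close> closed_Times) auto
  then have "compact ?A"
    by (intro compact_continuous_image continuous_intros)
  then have "open (- ?A)"
    using compact_imp_closed by blast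
  moreover have "x0 \<in> - ?A"
    using fibre \<open>F x0 < b\<close> by fastforce
  moreover have "F x < b" if "x \<in> - ?A" "x \<in> K" for x
  proof (rule ccontr)
    assume "\<not> F x < b"
    moreover obtain v where "F x \<le> v" "(x, v) \<in> H"
      using major \<open>x \<in> K\<close> by blast
    ultimately have "(x, v) \<in> H \<inter> UNIV \<times> {b..}" by auto
    then have "x \<in> ?A" by force
    with \<open>x \<in> - ?A\<close> show False by simp
  qed
  ultimately show ?thesis
    unfolding eventually_at_topological by blast
qed

lemma continuous_within_of_compact_bounds:
  fixes G H :: "('a::t2_space \<times> real) set"
  assumes "compact H"
    and "\<And>x. x \<in> K \<Longrightarrow> \<exists>v\<ge>F x. (x, v) \<in> H"
    and "\<And>v. (x0, v) \<in> H \<Longrightarrow> v \<le> F x0"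
    and "compact G"
    and minor: "\<And>x. x \<in> K \<Longrightarrow> \<exists>v\<le>F x. (x, v) \<in> G"
    and fibre: "\<And>v. (x0, v) \<in> G \<Longrightarrow> F x0 \<le> v"
  shows "(F \<longlongrightarrow> F x0) (at x0 within K)"
proof (rule order_tendstoI)
  fix b assume "F x0 < b"
  then show "\<forall>\<^sub>F x in at x0 within K. F x < b"
    using eventually_less_of_compact_majorant[of H K F x0 b] assms(1-3) by blast
next
  fix a assume "a < F x0"
  let ?r = "\<lambda>z::'a \<times> real. (fst z, - snd z)"
  have "compact (?r ` G)"
    by (intro compact_continuous_image continuous_intros \<open>compact G\<close>)
  moreover have "\<exists>v\<ge>- F x. (x, v) \<in> ?r ` G" if x: "x \<in> K" for x
  proof -
    obtain v where "v \<le> F x" "(x, v) \<in> G" using minor[OF x] by blast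
    then have "- F x \<le> - v" "(x, - v) \<in> ?r ` G" by force+
    then show ?thesis by blast
  qed
  moreover have "v \<le> - F x0" if "(x0, v) \<in> ?r ` G" for v
    using that fibre by fastforce
  ultimately have "\<forall>\<^sub>F x in at x0 within K. - F x < - a"
    using \<open>a < F x0\<close>
    by (intro eventually_less_of_compact_majorant[of "?r ` G" K "\<lambda>x. - F x"]) auto
  then show "\<forall>\<^sub>F x in at x0 within K. a < F x" by simp
qed

lemma convex_fun_on_subset:
  assumes "convex_fun_on T f" "S \<subseteq> T"
  shows "convex_fun_on S f"
  unfolding convex_fun_on_def
proof (intro allI impI)
  fix k :: nat and x and y :: "nat \<Rightarrow> 'a" and t :: "nat \<Rightarrow> real"
  assume H: "x \<in> S" "\<forall>j\<in>{1..k}. y j \<in> S" "\<forall>j\<in>{1..k}. t j \<in> {0..1}" "(\<Sum>j=1..k. t j) = 1"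
    "(\<Sum>j=1..k. t j *\<^sub>R y j) = x"
  have "x \<in> T" "\<forall>j\<in>{1..k}. y j \<in> T" using H(1,2) \<open>S \<subseteq> T\<close> by auto
  then show "f x \<le> (\<Sum>j=1..k. t j * f (y j))"
    using assms(1)[unfolded convex_fun_on_def, rule_format, of x k y t] H(3-5) by auto
qed

lemma convex_fun_on_le_hull_graph:
  fixes g :: "'a::real_vector \<Rightarrow> real"
  assumes "convex_fun_on D g" "x \<in> D"
    and "(x, v) \<in> convex hull ((\<lambda>x. (x, g x)) ` D)"
  shows "g x \<le> v"
proof -
  obtain k t z where t: "\<forall>i\<in>{1::nat..k}. 0 \<le> t i \<and> z i \<in> (\<lambda>x. (x, g x)) ` D"
    and sum1: "sum t {1..k} = 1" and sumz: "(\<Sum>i=1..k. t i *\<^sub>R z i) = (x, v)"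
    using assms(3) unfolding convex_hull_indexed by blast
  have z: "fst (z i) \<in> D" "snd (z i) = g (fst (z i))" if "i \<in> {1..k}" for i
    using bspec[OF t that] by auto
  have "t i \<le> 1" if "i \<in> {1..k}" for i
    using member_le_sum[of i "{1..k}" t] t that sum1 by auto
  moreover have "(\<Sum>i=1..k. t i *\<^sub>R fst (z i)) = x"
    using arg_cong[OF sumz, of fst] by (simp add: fst_sum)
  ultimately have "g x \<le> (\<Sum>i=1..k. t i * g (fst (z i)))"
    using assms(1)[unfolded convex_fun_on_def, rule_format, of x k "\<lambda>i. fst (z i)" t]
      \<open>x \<in> D\<close> t z(1) sum1 by auto
  also have "\<dots> = (\<Sum>i=1..k. t i * snd (z i))"
    by (intro sum.cong) (auto simp: z(2))
  also have "\<dots> = v"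
    using arg_cong[OF sumz, of snd] by (simp add: snd_sum)
  finally show ?thesis .
qed

text \<open>
  Over a compact convex set \<open>G\<close> the infimum of each fibre is attained, so convex combinations
  of lowest points lie in \<open>G\<close> again and lie above its lower boundary.
\<close>

lemma compact_convex_lower_boundary:
  fixes G :: "('a::real_normed_vector \<times> real) set"
  assumes "compact G" "convex G"
  obtains F where "convex_on (fst ` G) F"
    and "\<And>x. x \<in> fst ` G \<Longrightarrow> (x, F x) \<in> G"
    and "\<And>x v. (x, v) \<in> G \<Longrightarrow> F x \<le> v"
proof -
  have "\<exists>u. (x, u) \<in> G \<and> (\<forall>v. (x, v) \<in> G \<longrightarrow> u \<le> v)" if x: "x \<in> fst ` G" for x
  proof -
    have "compact (G \<inter> {x} \<times> UNIV)"
      by (intro compact_Int_closed \<open>compact G\<close> closed_Times) auto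
    moreover have "G \<inter> {x} \<times> UNIV \<noteq> {}" using x by auto
    moreover have "continuous_on (G \<inter> {x} \<times> UNIV) snd" by (intro continuous_intros)
    ultimately obtain z where "z \<in> G \<inter> {x} \<times> UNIV"
      and "\<And>w. w \<in> G \<inter> {x} \<times> UNIV \<Longrightarrow> snd z \<le> snd w"
      using continuous_attains_inf[of "G \<inter> {x} \<times> UNIV" snd] by blast
    then show ?thesis by (intro exI[of _ "snd z"]) force
  qed
  then obtain F where F: "\<And>x. x \<in> fst ` G \<Longrightarrow> (x, F x) \<in> G"
    and le: "\<And>x v. x \<in> fst ` G \<Longrightarrow> (x, v) \<in> G \<Longrightarrow> F x \<le> v"
    by metis
  have F_le: "F x \<le> v" if "(x, v) \<in> G" for x v
    using le[of x v] that by force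
  have "convex (fst ` G)"
    using \<open>convex G\<close> linear_fst by (rule convex_linear_image[rotated])
  have "convex_on (fst ` G) F"
  proof (rule convex_onI[OF _ \<open>convex (fst ` G)\<close>])
    fix t :: real and x y assume "0 < t" "t < 1" "x \<in> fst ` G" "y \<in> fst ` G"
    then have "(1 - t) *\<^sub>R (x, F x) + t *\<^sub>R (y, F y) \<in> G"
      using \<open>convex G\<close> F by (auto intro!: convexD simp del: scaleR_Pair add_Pair)
    then show "F ((1 - t) *\<^sub>R x + t *\<^sub>R y) \<le> (1 - t) * F x + t * F y"
      using F_le by simp
  qed
  with F F_le that show ?thesis by blast
qed

text \<open>
  The compact majorant is the cone with apex \<open>(p, F p)\<close> over the graph of \<open>F\<close> on the relative
  boundary. The hypothesis \<open>x0 = p \<or> x0 \<in> rel_frontier K\<close> makes its fibre over \<open>x0\<close>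
  a single point, because a boundary point lies on a segment from \<open>p\<close> to the boundary only
  as its far end.
\<close>

lemma convex_on_compact_cone_majorant:
  fixes K :: "'a::euclidean_space set"
  assumes "compact K" "convex_on K F" "continuous_on (rel_frontier K) F"
    and p: "p \<in> rel_interior K" and x0: "x0 = p \<or> x0 \<in> rel_frontier K"
  obtains H where "compact H" "\<And>x. x \<in> K \<Longrightarrow> \<exists>v\<ge>F x. (x, v) \<in> H"
    "\<And>v. (x0, v) \<in> H \<Longrightarrow> v \<le> F x0"
proof -
  have "convex K" using \<open>convex_on K F\<close> convex_on_imp_convex by blast
  have frontier_K: "rel_frontier K \<subseteq> K"
    using \<open>compact K\<close> by (auto simp: rel_frontier_def closure_closed compact_imp_closed)
  have "p \<in> K" using p rel_interior_subset by blast
  let ?c = "\<lambda>(y, s). ((1 - s) *\<^sub>R p + s *\<^sub>R y, (1 - s) * F p + s * F y)"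
  \<comment> \<open>The apex is listed separately because the relative boundary of a single point is empty.\<close>
  define H where "H = insert (p, F p) (?c ` (rel_frontier K \<times> {0..1}))"
  have "compact (rel_frontier K)"
    using \<open>compact K\<close> by (simp add: compact_imp_bounded compact_rel_frontier_bounded)
  moreover have "continuous_on (rel_frontier K \<times> {0..1}) ?c"
    unfolding case_prod_beta
    by (intro continuous_intros continuous_on_compose2[OF assms(3)]) auto
  ultimately have "compact H"
    unfolding H_def by (intro compact_insert compact_continuous_image compact_Times) auto
  moreover have "\<exists>v\<ge>F x. (x, v) \<in> H" if "x \<in> K" for x
  proof (cases "x = p")
    case True
    then show ?thesis unfolding H_def by auto
  next
    case False
    then obtain y where y: "y \<in> rel_frontier K" "x \<in> closed_segment p y"
      using segment_to_rel_frontier[of K p x] \<open>convex K\<close> \<open>compact K\<close> p \<open>x \<in> K\<close>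
      by (metis compact_imp_bounded)
    then obtain s where s: "0 \<le> s" "s \<le> 1" "x = (1 - s) *\<^sub>R p + s *\<^sub>R y"
      by (auto simp: in_segment)
    have "F x \<le> (1 - s) * F p + s * F y"
      using convex_onD[OF \<open>convex_on K F\<close>, of s p y] s y(1) \<open>p \<in> K\<close> frontier_K by auto
    moreover have "(x, (1 - s) * F p + s * F y) \<in> H"
      unfolding H_def using s y(1) by (intro insertI2 image_eqI[of _ _ "(y, s)"]) auto
    ultimately show ?thesis by blast
  qed
  moreover have "v \<le> F x0" if v: "(x0, v) \<in> H" for v
  proof (cases "(x0, v) = (p, F p)")
    case True
    then show ?thesis by simp
  next
    case False
    then obtain y s where y: "y \<in> rel_frontier K" "0 \<le> s" "s \<le> 1"
      and x0_eq: "x0 = (1 - s) *\<^sub>R p + s *\<^sub>R y" and v_eq: "v = (1 - s) * F p + s * F y"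
      using v unfolding H_def by auto
    have "y \<noteq> p" using y(1) p by (auto simp: rel_frontier_def)
    show ?thesis
    proof (cases "x0 = p")
      case True
      then have "s *\<^sub>R (y - p) = 0" using x0_eq by (simp add: algebra_simps)
      then have "s = 0" using \<open>y \<noteq> p\<close> by simp
      then show ?thesis using v_eq True by simp
    next
      case False
      have "open_segment p y \<subseteq> rel_interior K"
        using rel_interior_closure_convex_segment[OF \<open>convex K\<close> p] y(1)
        by (simp add: rel_frontier_def)
      moreover have "x0 \<notin> rel_interior K"
        using x0 False by (auto simp: rel_frontier_def)
      ultimately have "x0 \<notin> open_segment p y" by blast
      moreover have "x0 \<in> closed_segment p y"
        using x0_eq y(2,3) by (auto simp: in_segment)
      ultimately have "x0 = y"
        using False by (auto simp: open_segment_def)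
      have "(1 - s) *\<^sub>R (y - p) = y - x0" unfolding x0_eq by (simp add: algebra_simps)
      then have "(1 - s) *\<^sub>R (y - p) = 0" using \<open>x0 = y\<close> by simp
      then have "s = 1" using \<open>y \<noteq> p\<close> by simp
      then show ?thesis using v_eq \<open>x0 = y\<close> by simp
    qed
  qed
  ultimately show ?thesis using that by blast
qed

lemma extends_cont_convex_hull_if_rel_frontier_subset:
  fixes D :: "'a::euclidean_space set"
  assumes "compact D" "continuous_on D g" "convex_fun_on D g"
    and frontier_D: "rel_frontier (convex hull D) \<subseteq> D"
  shows "extends_cont_convex D g (convex hull D)"
proof -
  define K where "K = convex hull D"
  define G where "G = convex hull ((\<lambda>x. (x, g x)) ` D)"
  have "compact K" "convex K" "D \<subseteq> K"
    using \<open>compact D\<close> by (auto simp: K_def compact_convex_hull hull_subset)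
  have "compact ((\<lambda>x. (x, g x)) ` D)"
    by (intro compact_continuous_image continuous_intros assms)
  then have "compact G" "convex G"
    by (auto simp: G_def compact_convex_hull)
  have fst_G: "fst ` G = K"
    unfolding G_def K_def by (subst convex_hull_linear_image[OF linear_fst]) (simp add: image_image)
  obtain F where "convex_on K F"
    and F_in: "\<And>x. x \<in> K \<Longrightarrow> (x, F x) \<in> G" and F_le: "\<And>x v. (x, v) \<in> G \<Longrightarrow> F x \<le> v"
    using compact_convex_lower_boundary[OF \<open>compact G\<close> \<open>convex G\<close>] unfolding fst_G by blast
  have F_eq: "F x = g x" if "x \<in> D" for x
  proof (rule antisym)
    show "F x \<le> g x"
      using that by (auto simp: G_def intro!: F_le hull_inc)
    show "g x \<le> F x"
      using convex_fun_on_le_hull_graph[OF assms(3) that] F_in that \<open>D \<subseteq> K\<close>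
      unfolding G_def by blast
  qed
  have "continuous_on (rel_frontier K) F"
    using continuous_on_subset[OF assms(2) frontier_D] frontier_D
    by (subst continuous_on_cong[OF refl, of _ F g]) (auto simp: K_def F_eq)
  have "continuous_on K F"
    unfolding continuous_on_def
  proof
    fix x0 assume "x0 \<in> K"
    then have "rel_interior K \<noteq> {}"
      using \<open>convex K\<close> rel_interior_eq_empty by blast
    moreover have "x0 \<in> rel_interior K \<or> x0 \<in> rel_frontier K"
      using \<open>x0 \<in> K\<close> closure_subset by (auto simp: rel_frontier_def)
    ultimately obtain p where p: "p \<in> rel_interior K" "x0 = p \<or> x0 \<in> rel_frontier K"
      by blast
    obtain H where "compact H" "\<And>x. x \<in> K \<Longrightarrow> \<exists>v\<ge>F x. (x, v) \<in> H"
      "\<And>v. (x0, v) \<in> H \<Longrightarrow> v \<le> F x0"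
      using convex_on_compact_cone_majorant[OF \<open>compact K\<close> \<open>convex_on K F\<close>
          \<open>continuous_on (rel_frontier K) F\<close> p] by blast
    moreover have "\<exists>v\<le>F x. (x, v) \<in> G" if "x \<in> K" for x
      using F_in[OF that] by blast
    ultimately show "(F \<longlongrightarrow> F x0) (at x0 within K)"
      using continuous_within_of_compact_bounds[of H K F x0 G] \<open>compact G\<close> F_le by blast
  qed
  then show ?thesis
    using \<open>convex_on K F\<close> \<open>D \<subseteq> K\<close> F_eq convex_fun_on_iff_convex_on[OF \<open>convex K\<close>]
    unfolding extends_cont_convex_def K_def by blast
qed

theorem corollary1p2:
  fixes C :: "'a::euclidean_space set" and f :: "'a \<Rightarrow> real"
  assumes "compact C"
    and "continuous_on C f"
    and "convex_fun_on C f"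
  shows "extends_cont_convex C f (convex hull C) \<longleftrightarrow>
         extends_cont_convex C f (C \<union> rel_frontier (convex hull C))"
proof -
  let ?K = "convex hull C" and ?D = "C \<union> rel_frontier (convex hull C)"
  have "compact ?K" using \<open>compact C\<close> by (rule compact_convex_hull)
  then have "rel_frontier ?K \<subseteq> ?K"
    by (auto simp: rel_frontier_def closure_closed compact_imp_closed)
  then have D_K: "?D \<subseteq> ?K" by (simp add: hull_subset)
  have "compact ?D"
    using \<open>compact C\<close> \<open>compact ?K\<close>
    by (intro compact_Un) (auto simp: compact_imp_bounded compact_rel_frontier_bounded)
  have hull_D: "convex hull ?D = ?K"
    using D_K by (intro antisym hull_minimal hull_mono) auto
  show ?thesis
  proof
    assume "extends_cont_convex C f ?K"
    then show "extends_cont_convex C f ?D"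
      using D_K continuous_on_subset convex_fun_on_subset
      unfolding extends_cont_convex_def by (metis Un_upper1)
  next
    assume "extends_cont_convex C f ?D"
    then obtain g where "continuous_on ?D g" "convex_fun_on ?D g" and g: "\<forall>x\<in>C. g x = f x"
      unfolding extends_cont_convex_def by blast
    then have "extends_cont_convex ?D g ?K"
      using extends_cont_convex_hull_if_rel_frontier_subset[OF \<open>compact ?D\<close>] hull_D by auto
    then show "extends_cont_convex C f ?K"
      using g unfolding extends_cont_convex_def by (metis Un_iff le_sup_iff)
  qed
qed

end
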